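(* Let $G$ be a finite 2-edge-connected graph and let $A$ be an abelian group such that either $|A|\ge 6$ or $A=\mathbb{Z}_2\times\mathbb{Z}_2$. If the reconfiguration graph $\mathcal{F}(G,A)$ is non-empty, then every vertex of $\mathcal{F}(G,A)$ has degree at least $1$.
   Context: Graphs may have multiple edges but no loops. Fix an orientation $D$ of the edges of $G$. For an abelian group $A$ (written additively, neutral element $0_A$), an $A$-flow in $G$ is a map $f:E(G)\to A$ such that at every vertex $v$, the sum of $f(e)$ over arcs with tail $v$ equals the sum of $f(e)$ over arcs with head $v$. It is nowhere-zero if $f(e)\neq 0_A$ for all edges $e$. The support $\mathrm{supp}(f)$ is the set of edges with non-zero value. A cycle is a connected 2-regular subgraph (two parallel edges form a cycle). The reconfiguration graph $\mathcal{F}(G,A)$ has as vertices all nowhere-zero $A$-flows of $G$ (with respect to the fixed orientation), two flows $f,g$ being adjacent if $\mathrm{supp}(f-g)$ is the edge set of a cycle of $G$. *)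

theory Defs
  imports "Graph_Theory.Graph_Theory" "HOL-Library.Z2" "HOL-Library.Product_Plus"
    "HOL-Library.Extended_Nat" "HOL-Library.FuncSet"
begin

text \<open>
  A loopless multigraph together with a fixed orientation is a loopfree digraph in which parallel
  and antiparallel arcs are allowed: the arcs are the edges, the orientation is given by tail and
  head. All graph notions below (connectedness, degree, cycles) refer to the underlying undirected
  multigraph; the library's \<^const>\<open>Digraph_Component.connected\<close> already does so.
\<close>

definition edge_connected :: "nat \<Rightarrow> ('v, 'e) pre_digraph \<Rightarrow> bool" where
  "edge_connected k G \<longleftrightarrow>
     (\<exists>u \<in> verts G. \<exists>v \<in> verts G. u \<noteq> v) \<and>
     (\<forall>F \<subseteq> arcs G. finite F \<and> card F < k \<longrightarrow> Digraph_Component.connected (G\<lparr>arcs := arcs G - F\<rparr>))"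

definition edge_degree :: "('v, 'e) pre_digraph \<Rightarrow> 'v \<Rightarrow> nat" where
  "edge_degree G v = in_degree G v + out_degree G v"

definition cycle_of :: "('v, 'e) pre_digraph \<Rightarrow> ('v, 'e) pre_digraph \<Rightarrow> bool" where
  "cycle_of C G \<longleftrightarrow>
     subgraph C G \<and> Digraph_Component.connected C \<and> (\<forall>v \<in> verts C. edge_degree C v = 2)"

text \<open>
  Flows are maps on the edge set only, hence the extensionality requirement: without it, a flow
  would be represented by many total functions and vertices of the reconfiguration graph would be
  counted several times.
\<close>

definition flow :: "('v, 'e) pre_digraph \<Rightarrow> ('e \<Rightarrow> 'a::ab_group_add) \<Rightarrow> bool" where
  "flow G f \<longleftrightarrow>
     f \<in> extensional (arcs G) \<and>
     (\<forall>v \<in> verts G. (\<Sum>e \<in> out_arcs G v. f e) = (\<Sum>e \<in> in_arcs G v. f e))"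

definition flow_support :: "('v, 'e) pre_digraph \<Rightarrow> ('e \<Rightarrow> 'a::zero) \<Rightarrow> 'e set" where
  "flow_support G f = {e \<in> arcs G. f e \<noteq> 0}"

definition nowhere_zero_flow :: "('v, 'e) pre_digraph \<Rightarrow> ('e \<Rightarrow> 'a::ab_group_add) \<Rightarrow> bool" where
  "nowhere_zero_flow G f \<longleftrightarrow> flow G f \<and> (\<forall>e \<in> arcs G. f e \<noteq> 0)"

text \<open>
  The (undirected, simple) reconfiguration graph, represented by its vertex set and its symmetric
  adjacency relation. The group is the type \<open>'a\<close>.
\<close>

definition reconf_graph ::
    "('v, 'e) pre_digraph \<Rightarrow> ('e \<Rightarrow> 'a::ab_group_add) pair_pre_digraph" where
  "reconf_graph G =
     \<lparr> pverts = {f. nowhere_zero_flow G f},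
       parcs = {(f, g). nowhere_zero_flow G f \<and> nowhere_zero_flow G g \<and>
                  (\<exists>C. cycle_of C G \<and> flow_support G (\<lambda>e. f e - g e) = arcs C)} \<rparr>"

lemma sym_parcs_reconf_graph: "sym (parcs (reconf_graph G))"
  by (force simp: sym_def reconf_graph_def flow_support_def)

text \<open>
  Cardinality with value \<open>\<infinity>\<close> on infinite sets. The group may be infinite, and then so may be the
  degrees in the reconfiguration graph, while \<^const>\<open>card\<close> is \<open>0\<close> on infinite sets.
\<close>

definition ecard :: "'b set \<Rightarrow> enat" where
  "ecard S = (if finite S then enat (card S) else \<infinity>)"

definition vertex_degree :: "'b pair_pre_digraph \<Rightarrow> 'b \<Rightarrow> enat" where
  "vertex_degree R x = ecard {y. (x, y) \<in> parcs R}"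

definition additive_iso :: "('b::ab_group_add \<Rightarrow> 'c::ab_group_add) \<Rightarrow> bool" where
  "additive_iso h \<longleftrightarrow> bij h \<and> (\<forall>x y. h (x + y) = h x + h y)"

end

theory Submission
  imports Defs
begin

text \<open>
  The hypothesis on the group says that its non-zero elements fall into at least three classes
  \<open>{x, -x}\<close>. Pick three such classes, of \<open>a\<close>, \<open>b\<close> and \<open>c\<close>, and let \<open>f\<close> be a nowhere-zero
  flow. If some \<open>x \<in> {a, b, c}\<close> admits a cycle on which \<open>f\<close> avoids \<open>\<plusminus>x\<close>, then adding the
  value \<open>x\<close> along the cycle yields a neighbour of \<open>f\<close>. To find the cycle, colour the edges by
  \<open>\<plusminus>a\<close>, \<open>\<plusminus>b\<close> and everything else, and let \<open>F\<^sub>i\<close> be the set of edges not of colour \<open>i\<close>.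
  Each edge lies in exactly two of the \<open>F\<^sub>i\<close>. A vertex \<open>v\<close> is covered by at most \<open>deg v\<close> of
  them, because at a vertex of degree 2 both edges have the same colour by conservation. If all
  \<open>F\<^sub>i\<close> were forests, then \<open>2 |E| = \<Sum> |F\<^sub>i| < \<Sum> |V(F\<^sub>i)| \<le> \<Sum> deg v = 2 |E|\<close>,
  a contradiction.
\<close>

locale loopfree_fin_digraph = fin_digraph + loopfree_digraph
begin

section \<open>Edge sets, their ends, and density\<close>

definition ends :: "'b set \<Rightarrow> 'a set" where
  "ends F = tail G ` F \<union> head G ` F"

definition inc :: "'b set \<Rightarrow> 'a \<Rightarrow> 'b set" where
  "inc F v = {e \<in> F. tail G e = v \<or> head G e = v}"

text \<open>A non-empty forest has fewer edges than ends, so density certifies a cycle by counting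
  alone.\<close>

definition is_dense :: "'b set \<Rightarrow> bool" where
  "is_dense F \<longleftrightarrow> F \<subseteq> arcs G \<and> F \<noteq> {} \<and> card (ends F) \<le> card F"

text \<open>The minimal dense edge sets turn out to be exactly the edge sets of cycles.\<close>

definition min_dense :: "'b set \<Rightarrow> bool" where
  "min_dense F \<longleftrightarrow> is_dense F \<and> (\<forall>F'. F' \<subset> F \<longrightarrow> \<not> is_dense F')"

definition netflow :: "('b \<Rightarrow> 'c::ab_group_add) \<Rightarrow> 'a \<Rightarrow> 'c" where
  "netflow h v = (\<Sum>e\<in>out_arcs G v. h e) - (\<Sum>e\<in>in_arcs G v. h e)"

lemma finite_sub_arcs: "F \<subseteq> arcs G \<Longrightarrow> finite F"
  by (rule finite_subset) auto

lemma finite_ends: "F \<subseteq> arcs G \<Longrightarrow> finite (ends F)"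
  by (simp add: ends_def finite_sub_arcs)

lemma ends_subset_verts: "F \<subseteq> arcs G \<Longrightarrow> ends F \<subseteq> verts G"
  by (auto simp: ends_def)

lemma ex_min_dense:
  assumes "is_dense E"
  obtains F where "F \<subseteq> E" "min_dense F"
proof -
  have fin: "finite E" using assms by (auto simp: is_dense_def finite_sub_arcs)
  have "finite {F. F \<subseteq> E \<and> is_dense F}" by (rule finite_subset[of _ "Pow E"]) (auto simp: fin)
  then obtain F where "F \<in> {F. F \<subseteq> E \<and> is_dense F}"
    and "\<forall>F' \<in> {F. F \<subseteq> E \<and> is_dense F}. F' \<subseteq> F \<longrightarrow> F = F'"
    using assms finite_has_minimal[of "{F. F \<subseteq> E \<and> is_dense F}"] by blast
  then have "F \<subseteq> E" "min_dense F" unfolding min_dense_def by auto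
  then show thesis by (rule that)
qed

text \<open>Double counting: without loops each edge has two distinct ends. \<open>V\<close> is
  instantiated both with \<open>ends F\<close> and with \<open>verts G\<close>.\<close>

lemma handshake:
  assumes "F \<subseteq> arcs G" "ends F \<subseteq> V" "finite V"
  shows "(\<Sum>v\<in>V. card (inc F v)) = 2 * card F"
proof -
  have "card {v \<in> V. tail G e = v \<or> head G e = v} = 2" if "e \<in> F" for e
  proof -
    have "{v \<in> V. tail G e = v \<or> head G e = v} = {tail G e, head G e}"
      using that assms by (auto simp: ends_def)
    then show ?thesis using no_loops[of e] that assms by auto
  qed
  then show ?thesis
    unfolding inc_def using assms
    by (intro sum_multicount) (auto simp: finite_sub_arcs)
qed

section \<open>Minimal dense sets are cycles\<close>

text \<open>By minimality, fewer than \<open>card S\<close> edges lie inside \<open>S\<close>, and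
  likewise for the complement. Density of \<open>F\<close> then leaves at least two edges for the
  cut.\<close>

lemma min_dense_cut:
  assumes F: "min_dense F" and S: "S \<subseteq> ends F" "S \<noteq> {}" "S \<noteq> ends F"
  shows "2 \<le> card {e \<in> F. (tail G e \<in> S) \<noteq> (head G e \<in> S)}"
proof -
  define F1 F2 X where "F1 = {e \<in> F. tail G e \<in> S \<and> head G e \<in> S}"
    and "F2 = {e \<in> F. tail G e \<notin> S \<and> head G e \<notin> S}"
    and "X = {e \<in> F. (tail G e \<in> S) \<noteq> (head G e \<in> S)}"
  have FG: "F \<subseteq> arcs G" and le: "card (ends F) \<le> card F"
    using F by (auto simp: min_dense_def is_dense_def)
  note fin = finite_sub_arcs[OF FG] finite_ends[OF FG]
  have small: "card F' < card T"
    if "F' \<subseteq> F" "ends F' \<subseteq> T" "T \<subset> ends F" "T \<noteq> {}" for F' T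
  proof (cases "F' = {}")
    case True
    then show ?thesis using that fin by (auto simp: card_gt_0_iff intro: finite_subset)
  next
    case False
    have "F' \<subset> F" using that by auto
    then have "\<not> is_dense F'" using F by (simp add: min_dense_def)
    then have "card F' < card (ends F')" using False that FG by (auto simp: is_dense_def)
    also have "\<dots> \<le> card T"
      using that fin by (intro card_mono) (auto intro: finite_subset)
    finally show ?thesis .
  qed
  have "card F1 < card S"
    using S by (intro small) (auto simp: F1_def ends_def)
  moreover have "card F2 < card (ends F - S)"
    using S by (intro small) (auto simp: F2_def ends_def)
  moreover have "card (ends F - S) + card S = card (ends F)"
    using S(1) fin
    by (metis card_Diff_subset card_mono finite_subset le_add_diff_inverse2)
  moreover have "card F = card F1 + card F2 + card X"
  proof -
    have "F = (F1 \<union> F2) \<union> X" by (auto simp: F1_def F2_def X_def)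
    moreover have "card ((F1 \<union> F2) \<union> X) = card (F1 \<union> F2) + card X"
      using fin by (intro card_Un_disjoint) (auto simp: F1_def F2_def X_def)
    moreover have "card (F1 \<union> F2) = card F1 + card F2"
      using fin by (intro card_Un_disjoint) (auto simp: F1_def F2_def)
    ultimately show ?thesis by simp
  qed
  ultimately show ?thesis using le by (simp add: X_def)
qed

text \<open>An induction principle on \<open>ends F\<close>: otherwise some non-trivial cut would
  contain no edge except possibly \<open>d\<close>. In effect \<open>F\<close> stays connected
  without \<open>d\<close>; when every edge respects \<open>S\<close>, \<open>d\<close> is
  arbitrary.\<close>

lemma min_dense_closed:
  assumes F: "min_dense F" and S: "S \<inter> ends F \<noteq> {}"
    and closed: "\<And>e. e \<in> F - {d} \<Longrightarrow> tail G e \<in> S \<longleftrightarrow> head G e \<in> S"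
  shows "ends F \<subseteq> S"
proof (rule ccontr)
  assume "\<not> ends F \<subseteq> S"
  then have "2 \<le> card {e \<in> F. (tail G e \<in> S \<inter> ends F) \<noteq> (head G e \<in> S \<inter> ends F)}"
    using S by (intro min_dense_cut F) auto
  also have "\<dots> \<le> card {d}"
    using closed by (intro card_mono) (auto simp: ends_def)
  finally show False by simp
qed

text \<open>Cuts around single vertices give degree at least 2. If \<open>card F\<close> exceeded
  \<open>card (ends F)\<close>, an edge could be dropped; so the degrees average 2 and all equal
  2.\<close>

lemma min_dense_card_inc:
  assumes F: "min_dense F" and v: "v \<in> ends F"
  shows "card (inc F v) = 2"
proof -
  have FG: "F \<subseteq> arcs G" and ne: "F \<noteq> {}" and le: "card (ends F) \<le> card F"
    using F by (auto simp: min_dense_def is_dense_def)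
  note fin = finite_sub_arcs[OF FG] finite_ends[OF FG]
  have ge: "2 \<le> card (inc F u)" if u: "u \<in> ends F" for u
  proof -
    obtain e where "e \<in> F" using ne by blast
    then have "tail G e \<in> ends F" "head G e \<in> ends F" "tail G e \<noteq> head G e"
      using FG no_loops by (auto simp: ends_def)
    then have "ends F \<noteq> {u}" by auto
    then have "2 \<le> card {e \<in> F. (tail G e \<in> {u}) \<noteq> (head G e \<in> {u})}"
      using u by (intro min_dense_cut F) auto
    also have "\<dots> \<le> card (inc F u)"
      using fin by (intro card_mono) (auto simp: inc_def)
    finally show ?thesis .
  qed
  have "card F \<le> card (ends F)"
  proof (rule ccontr)
    assume less: "\<not> card F \<le> card (ends F)"
    obtain e where e: "e \<in> F" using ne by auto
    \<comment> \<open>Both ends of \<open>e\<close> lie in \<open>ends F\<close>, so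
      \<open>card F\<close> is at least 3 and \<open>F - {e}\<close> stays non-empty, as density
      demands.\<close>
    have two: "card (ends {e}) = 2" using no_loops[of e] e FG by (auto simp: ends_def)
    have sub: "ends (F - {e}) \<subseteq> ends F" by (auto simp: ends_def)
    then have c: "card (ends (F - {e})) \<le> card (ends F)" using fin by (intro card_mono)
    have "card (ends {e}) \<le> card (ends F)" using e fin by (intro card_mono) (auto simp: ends_def)
    then have "card (F - {e}) \<noteq> 0" using less two e fin by auto
    then have "F - {e} \<noteq> {}" by (metis card.empty)
    then have "is_dense (F - {e})" using less c e FG fin by (auto simp: is_dense_def)
    then show False using F e by (auto simp: min_dense_def)
  qed
  with handshake[OF FG order_refl fin(2)] le
  have sum: "(\<Sum>u\<in>ends F. card (inc F u)) = (\<Sum>u\<in>ends F. 2)" by simp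
  show ?thesis
  proof (rule ccontr)
    assume "card (inc F v) \<noteq> 2"
    with ge[OF v] have "2 < card (inc F v)" by simp
    then have "(\<Sum>u\<in>ends F. 2) < (\<Sum>u\<in>ends F. card (inc F u))"
      using ge v fin by (intro sum_strict_mono_ex1) auto
    with sum show False by simp
  qed
qed

text \<open>The vertices reachable from \<open>u\<close> are closed under the edges of
  \<open>F\<close>, hence all of \<open>ends F\<close>. Without loops, in- and out-arcs are
  disjoint, so \<open>inc\<close> counts the degree.\<close>

lemma min_dense_cycle_of:
  assumes F: "min_dense F"
  shows "cycle_of \<lparr>verts = ends F, arcs = F, tail = tail G, head = head G\<rparr> G" (is "cycle_of ?C G")
proof -
  have FG: "F \<subseteq> arcs G" and ne: "F \<noteq> {}"
    using F by (auto simp: min_dense_def is_dense_def)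
  note fin = finite_sub_arcs[OF FG]
  interpret C: wf_digraph ?C by unfold_locales (auto simp: ends_def)
  have "subgraph ?C G"
    using ends_subset_verts[OF FG] FG C.wf_digraph wf_digraph
    by (simp add: subgraph_def compatible_def)
  moreover have "Digraph_Component.connected ?C"
    unfolding connected_conv
  proof (intro conjI ballI)
    show "verts ?C \<noteq> {}" using ne by (auto simp: ends_def)
    fix u v assume u: "u \<in> verts ?C" and v: "v \<in> verts ?C"
    define R where "R = rtrancl_on (verts ?C) ((arcs_ends ?C)\<^sup>s)"
    have adj: "(tail G e, head G e) \<in> (arcs_ends ?C)\<^sup>s" "(head G e, tail G e) \<in> (arcs_ends ?C)\<^sup>s"
      if "e \<in> F" for e
      using that by (force simp: symcl_def arcs_ends_conv)+
    have "tail G e \<in> {w. (u, w) \<in> R} \<longleftrightarrow> head G e \<in> {w. (u, w) \<in> R}" if "e \<in> F" for e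
    proof -
      have "tail G e \<in> verts ?C" "head G e \<in> verts ?C" using that by (auto simp: ends_def)
      with adj[OF that] show ?thesis
        unfolding R_def mem_Collect_eq by (meson rtrancl_on_into_rtrancl_on)
    qed
    then have "ends F \<subseteq> {w. (u, w) \<in> R}"
      using u by (intro min_dense_closed[OF F]) (auto simp: R_def)
    then show "(u, v) \<in> rtrancl_on (verts ?C) ((arcs_ends ?C)\<^sup>s)" using v by (auto simp: R_def)
  qed
  moreover have "edge_degree ?C v = 2" if "v \<in> verts ?C" for v
  proof -
    have "inc F v = in_arcs ?C v \<union> out_arcs ?C v" by (auto simp: inc_def in_arcs_def out_arcs_def)
    then have "card (inc F v) = edge_degree ?C v"
      unfolding edge_degree_def in_degree_def out_degree_def
      using fin FG no_loops
      by (auto intro!: card_Un_disjoint simp: in_arcs_def out_arcs_def)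
    then show ?thesis using min_dense_card_inc[OF F] that by simp
  qed
  ultimately show ?thesis by (simp add: cycle_of_def)
qed

section \<open>Net outflow and circulations around cycles\<close>

lemma netflow_zero: "netflow (\<lambda>e. 0) v = 0"
  by (simp add: netflow_def)

lemma netflow_add: "netflow (\<lambda>e. h e + k e) v = netflow h v + netflow k v"
  by (simp add: netflow_def sum.distrib)

lemma netflow_single:
  assumes "e \<in> arcs G"
  shows "netflow (\<lambda>d. if d = e then x else 0) v =
    (if v = tail G e then x else 0) - (if v = head G e then x else 0)"
proof -
  have "finite (out_arcs G v)" "finite (in_arcs G v)" by auto
  then show ?thesis using assms by (auto simp: netflow_def sum.delta)
qed

text \<open>A single signed sum over the incident edges lets degrees 1 and 2 be treated whatever the
  orientation.\<close>

lemma netflow_inc: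
  assumes F: "F \<subseteq> arcs G" and supp: "\<And>e. e \<in> arcs G - F \<Longrightarrow> h e = 0"
  shows "netflow h v = (\<Sum>e\<in>inc F v. if tail G e = v then h e else - h e)"
proof -
  have fin: "finite (inc F v)" using F by (auto simp: inc_def finite_sub_arcs)
  have supp': "e \<in> F" if "e \<in> arcs G" "h e \<noteq> 0" for e using supp that by blast
  have "(\<Sum>e\<in>out_arcs G v. h e) = (\<Sum>e\<in>inc F v \<inter> {e. tail G e = v}. h e)"
    using F supp' by (intro sum.mono_neutral_right) (auto simp: inc_def)
  moreover have "(\<Sum>e\<in>in_arcs G v. h e) = (\<Sum>e\<in>inc F v \<inter> - {e. tail G e = v}. h e)"
    using F supp' by (intro sum.mono_neutral_right) (auto simp: inc_def no_loops[symmetric])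
  ultimately show ?thesis
    using fin by (simp add: netflow_def sum.If_cases sum_negf)
qed

lemma netflow_eq_0_card_inc_2:
  assumes F: "F \<subseteq> arcs G" and supp: "\<And>e. e \<in> arcs G - F \<Longrightarrow> h e = 0"
    and netflow: "netflow h v = 0" and two: "card (inc F v) = 2" and de: "d \<in> inc F v" "e \<in> inc F v"
  shows "h e = h d \<or> h e = - h d"
proof (cases "d = e")
  case False
  obtain p q where "inc F v = {p, q}" "p \<noteq> q" using two by (auto simp: card_2_iff)
  with de False have "inc F v = {d, e}" by auto
  then show ?thesis
    using False netflow netflow_inc[OF F supp]
    by (auto simp: add_eq_0_iff split: if_splits)
qed simp

text \<open>The value \<open>x\<close> is sent once around the cycle, without listing its edges in
  order: \<open>x\<close> is routed from \<open>tail G d\<close> to \<open>head G d\<close> avoiding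
  \<open>d\<close>, and \<open>- x\<close> on \<open>d\<close> closes it up.\<close>

lemma min_dense_circulation:
  fixes x :: "'c::ab_group_add"
  assumes F: "min_dense F"
  obtains h where "\<And>v. netflow h v = 0" "\<And>e. e \<notin> F \<Longrightarrow> h e = 0"
    "\<And>e. e \<in> F \<Longrightarrow> h e = x \<or> h e = - x"
proof -
  have FG: "F \<subseteq> arcs G" and ne: "F \<noteq> {}"
    using F by (auto simp: min_dense_def is_dense_def)
  then obtain d where d: "d \<in> F" by auto
  define unit :: "'a \<Rightarrow> 'a \<Rightarrow> 'c" where "unit = (\<lambda>w v. if v = w then x else 0)"
  \<comment> \<open>\<open>S\<close> is the set of vertices to which \<open>x\<close> units can be routed in \<open>F - {d}\<close>. No cut of
    \<open>F\<close> consists of \<open>d\<close> alone, so \<open>S\<close> contains both ends of \<open>d\<close>.\<close>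
  define S where "S = {w. \<exists>h. (\<forall>e. e \<notin> F - {d} \<longrightarrow> h e = 0) \<and>
    (\<forall>v. netflow h v = unit w v - unit (head G d) v)}"
  have step: "w' \<in> S" if w: "w \<in> S" and e: "e \<in> F - {d}"
    and ww': "{w, w'} = {tail G e, head G e}" for w w' e
  proof -
    obtain h where h: "\<And>e. e \<notin> F - {d} \<Longrightarrow> h e = 0"
      "\<And>v. netflow h v = unit w v - unit (head G d) v" using w by (auto simp: S_def)
    \<comment> \<open>Adding \<open>y\<close> on \<open>e\<close> moves the source of the
      \<open>x\<close> units from \<open>w\<close> to \<open>w'\<close>; the sign depends on which
      end of \<open>e\<close> is \<open>w\<close>.\<close>
    define y where "y = (if w = tail G e then - x else x)"
    define h' where "h' = (\<lambda>a. h a + (if a = e then y else 0))"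
    have eG: "e \<in> arcs G" using e FG by auto
    have "netflow h' v = unit w' v - unit (head G d) v" for v
      unfolding h'_def netflow_add netflow_single[OF eG] h(2)
      using ww' no_loops[OF eG] by (auto simp: unit_def y_def doubleton_eq_iff)
    moreover have "h' a = 0" if "a \<notin> F - {d}" for a using that e h(1)[of a] by (auto simp: h'_def)
    ultimately show ?thesis unfolding S_def by blast
  qed
  have "head G d \<in> S" unfolding S_def by (auto intro!: exI[of _ "\<lambda>_. 0"] simp: netflow_zero)
  moreover have "tail G e \<in> S \<longleftrightarrow> head G e \<in> S" if "e \<in> F - {d}" for e
    using step[OF _ that] by blast
  ultimately have "ends F \<subseteq> S"
    using d by (intro min_dense_closed[OF F, of _ d]) (auto simp: ends_def)
  then have "tail G d \<in> S" using d by (auto simp: ends_def)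
  then obtain h where h: "\<And>e. e \<notin> F - {d} \<Longrightarrow> h e = 0"
    "\<And>v. netflow h v = unit (tail G d) v - unit (head G d) v" by (auto simp: S_def)
  define k where "k = (\<lambda>e. h e + (if e = d then - x else 0))"
  have dG: "d \<in> arcs G" using d FG by auto
  have k0: "k e = 0" if "e \<notin> F" for e using that d h(1)[of e] by (auto simp: k_def)
  have netflow_k: "netflow k v = 0" for v
    unfolding k_def netflow_add netflow_single[OF dG] h(2) by (auto simp: unit_def)
  \<comment> \<open>The routing avoids \<open>d\<close>, so the value there is exact. On the other
    edges nothing is known yet, as a routing may use an edge repeatedly.\<close>
  have kd: "k d = - x" using h(1)[of d] by (simp add: k_def)
  \<comment> \<open>The value \<open>\<plusminus>x\<close> propagates from \<open>d\<close> through the vertices of \<open>F\<close>, which have degree 2.\<close>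
  define T where "T = {v. \<exists>e\<in>inc F v. k e = x \<or> k e = - x}"
  have pm: "k e = x \<or> k e = - x" if e: "e \<in> inc F v" and v: "v \<in> T" for e v
  proof -
    obtain a where a: "a \<in> inc F v" "k a = x \<or> k a = - x" using v by (auto simp: T_def)
    then have "card (inc F v) = 2" by (intro min_dense_card_inc F) (auto simp: inc_def ends_def)
    then show ?thesis
      using netflow_eq_0_card_inc_2[OF FG _ netflow_k _ a(1) e] k0 a(2) by auto
  qed
  have "tail G e \<in> T \<longleftrightarrow> head G e \<in> T" if "e \<in> F" for e
  proof -
    have "e \<in> inc F (tail G e)" "e \<in> inc F (head G e)" using that by (auto simp: inc_def)
    then show ?thesis using pm unfolding T_def by blast
  qed
  moreover have "tail G d \<in> T" using d kd by (auto simp: T_def inc_def)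
  ultimately have T: "ends F \<subseteq> T"
    using d by (intro min_dense_closed[OF F]) (auto simp: ends_def)
  have "k e = x \<or> k e = - x" if "e \<in> F" for e
    using that T by (intro pm[of _ "tail G e"]) (auto simp: inc_def ends_def)
  with netflow_k k0 show thesis by (rule that)
qed

section \<open>Counting with three colours\<close>

text \<open>The counting argument separated from flows: conservation enters through
  \<open>deg1\<close> and \<open>deg2\<close>.\<close>

lemma three_colouring_dense:
  fixes col :: "'b \<Rightarrow> nat"
  assumes ne: "arcs G \<noteq> {}" and col: "\<And>e. e \<in> arcs G \<Longrightarrow> col e < 3"
    and deg1: "\<And>v. v \<in> verts G \<Longrightarrow> card (inc (arcs G) v) \<noteq> 1"
    and deg2: "\<And>v d e. v \<in> verts G \<Longrightarrow> card (inc (arcs G) v) = 2 \<Longrightarrow>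
      d \<in> inc (arcs G) v \<Longrightarrow> e \<in> inc (arcs G) v \<Longrightarrow> col d = col e"
  shows "\<exists>i<3. is_dense {e \<in> arcs G. col e \<noteq> i}"
proof (rule ccontr)
  assume no: "\<not> ?thesis"
  define F where "F i = {e \<in> arcs G. col e \<noteq> i}" for i
  have FG: "F i \<subseteq> arcs G" for i by (auto simp: F_def)
  have lt: "card (F i) < card (ends (F i))" if "i < 3" "F i \<noteq> {}" for i
    using no that FG[of i] by (auto simp: is_dense_def F_def not_le)
  have le: "card (F i) \<le> card (ends (F i))" if "i < 3" for i
    using lt[OF that] by (cases "F i = {}") auto
  \<comment> \<open>Empty sets satisfy only the non-strict bound, so a non-empty \<open>F i\<close>
    must supply the strict inequality.\<close>
  have "\<exists>i<3. F i \<noteq> {}"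
  proof -
    obtain e where e: "e \<in> arcs G" using ne by auto
    have "\<exists>i<3. col e \<noteq> i" by (cases "col e = 0") (force intro: exI[of _ 1] exI[of _ 0])+
    then show ?thesis using e by (auto simp: F_def)
  qed
  then have "(\<Sum>i<3. card (F i)) < (\<Sum>i<3. card (ends (F i)))"
    using lt le by (intro sum_strict_mono_ex1) auto
  moreover have "(\<Sum>i<3. card (F i)) = 2 * card (arcs G)"
    unfolding F_def
  proof (rule sum_multicount)
    show "\<forall>e\<in>arcs G. card {i \<in> {..<3}. col e \<noteq> i} = 2"
    proof
      fix e assume "e \<in> arcs G"
      then have "card ({..<3} - {col e}) = 2" using col[of e] by simp
      moreover have "{i \<in> {..<3}. col e \<noteq> i} = {..<3} - {col e}" by auto
      ultimately show "card {i \<in> {..<3}. col e \<noteq> i} = 2" by simp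
    qed
  qed auto
  moreover have "(\<Sum>i<3. card (ends (F i))) = (\<Sum>v\<in>verts G. card {i \<in> {..<3}. v \<in> ends (F i)})"
  proof -
    have "(\<Sum>i<3. card (ends (F i))) = (\<Sum>i<3. card {v \<in> verts G. v \<in> ends (F i)})"
      using ends_subset_verts[OF FG] by (intro sum.cong) (auto intro: arg_cong[where f = card])
    also have "\<dots> = (\<Sum>v\<in>verts G. card {i \<in> {..<3}. v \<in> ends (F i)})"
      by (intro sum_multicount_gen) auto
    finally show ?thesis .
  qed
  moreover have "\<dots> \<le> (\<Sum>v\<in>verts G. card (inc (arcs G) v))"
  proof (rule sum_mono)
    fix v assume v: "v \<in> verts G"
    let ?I = "inc (arcs G) v"
    let ?C = "{i \<in> {..<3}. v \<in> ends (F i)}"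
    have C: "\<exists>e\<in>?I. col e \<noteq> i" if "i \<in> ?C" for i
      using that by (auto simp: ends_def F_def inc_def)
    have finI: "finite ?I" by (auto simp: inc_def)
    \<comment> \<open>At degree 1 the bound would fail, since the edge lies in two of the three
      sets. At degree 2 the set omitting the common colour misses \<open>v\<close>.\<close>
    consider "?I = {}" | "card ?I = 2" | "card ?I \<ge> 3"
      using deg1[OF v] finI
      by (metis One_nat_def card_0_eq less_2_cases not_less_eq_eq numeral_2_eq_2 numeral_3_eq_3
          nat_neq_iff not_le)
    then show "card ?C \<le> card ?I"
    proof cases
      case 1
      then have "?C = {}" using C by blast
      then show ?thesis by (simp only: card.empty)
    next
      case 2
      then obtain d where d: "d \<in> ?I" by fastforce
      have "?C \<subseteq> {..<3} - {col d}" using C deg2[OF v 2 d] by fastforce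
      then have "card ?C \<le> card ({..<3} - {col d})" by (intro card_mono) auto
      also have "\<dots> = 2" using d col[of d] by (simp add: inc_def)
      finally show ?thesis using 2 by simp
    next
      case 3
      have "card ?C \<le> card {..<3::nat}" by (intro card_mono) auto
      then show ?thesis using 3 by simp
    qed
  qed
  moreover have "\<dots> = 2 * card (arcs G)"
    by (intro handshake ends_subset_verts) auto
  ultimately show False by simp
qed

section \<open>Changing a nowhere-zero flow along a cycle\<close>

lemma nowhere_zero_flow_netflow:
  assumes "nowhere_zero_flow G f" "v \<in> verts G"
  shows "netflow f v = 0"
  using assms by (simp add: nowhere_zero_flow_def flow_def netflow_def)

text \<open>Conservation supplies both degree conditions: a single incident edge would carry 0, and
  two incident edges carry values equal up to sign, hence of the same colour.\<close>

lemma nowhere_zero_flow_min_dense_avoiding: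
  fixes f :: "'b \<Rightarrow> 'c::ab_group_add"
  assumes f: "nowhere_zero_flow G f" and ne: "arcs G \<noteq> {}"
    and abc: "b \<notin> {a, - a}" "c \<notin> {a, - a, b, - b}"
  obtains x F where "x \<in> {a, b, c}" "min_dense F" "\<And>e. e \<in> F \<Longrightarrow> f e \<notin> {x, - x}"
proof -
  define col where "col e = (if f e \<in> {a, - a} then 0 else if f e \<in> {b, - b} then 1 else 2 :: nat)" for e
  have f0: "f e \<noteq> 0" if "e \<in> arcs G" for e using f that by (simp add: nowhere_zero_flow_def)
  have "\<exists>i<3. is_dense {e \<in> arcs G. col e \<noteq> i}"
  proof (rule three_colouring_dense[of col])
    show "arcs G \<noteq> {}" by (rule ne)
    show "col e < 3" for e by (simp add: col_def)
    fix v assume v: "v \<in> verts G"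
    note netflow = nowhere_zero_flow_netflow[OF f v]
    show "card (inc (arcs G) v) \<noteq> 1"
    proof
      assume "card (inc (arcs G) v) = 1"
      then obtain e where e: "inc (arcs G) v = {e}" by (auto simp: card_1_singleton_iff)
      have "netflow f v = (\<Sum>e\<in>inc (arcs G) v. if tail G e = v then f e else - f e)"
        by (rule netflow_inc) auto
      then have "f e = 0" unfolding netflow e by (simp split: if_splits)
      moreover have "e \<in> arcs G" using e by (auto simp: inc_def)
      ultimately show False using f0 by blast
    qed
    fix d e assume "card (inc (arcs G) v) = 2" "d \<in> inc (arcs G) v" "e \<in> inc (arcs G) v"
    then have "f e = f d \<or> f e = - f d" using netflow by (intro netflow_eq_0_card_inc_2) auto
    then have "f e \<in> {y, - y} \<longleftrightarrow> f d \<in> {y, - y}" for y by auto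
    then show "col d = col e" by (simp only: col_def)
  qed
  then obtain i where i: "i < 3" and dense: "is_dense {e \<in> arcs G. col e \<noteq> i}" by blast
  obtain F where F: "F \<subseteq> {e \<in> arcs G. col e \<noteq> i}" "min_dense F" using ex_min_dense[OF dense] .
  \<comment> \<open>Colour 2 may be wider than the class of \<open>c\<close>; a cycle without it
    carries only the values \<plusminus>a and \<plusminus>b, which differ from
    \<plusminus>c.\<close>
  define x where "x = (if i = 0 then a else if i = 1 then b else c)"
  have "f e \<notin> {x, - x}" if "e \<in> F" for e
  proof -
    have "col e \<noteq> i" using that F by auto
    then show ?thesis
      using i abc
      by (auto simp: col_def x_def less_Suc_eq numeral_3_eq_3 minus_equation_iff
          equation_minus_iff split: if_splits)
  qed
  moreover have "x \<in> {a, b, c}" by (simp add: x_def)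
  ultimately show thesis using F(2) that by blast
qed

text \<open>Both signs are avoided because the circulation may take either on an edge of
  \<open>F\<close>.\<close>

lemma nowhere_zero_flow_add_circulation:
  fixes f :: "'b \<Rightarrow> 'c::ab_group_add"
  assumes f: "nowhere_zero_flow G f" and F: "min_dense F"
    and x: "x \<noteq> 0" and avoid: "\<And>e. e \<in> F \<Longrightarrow> f e \<notin> {x, - x}"
  obtains g where "(f, g) \<in> parcs (reconf_graph G)"
proof -
  have FG: "F \<subseteq> arcs G" using F by (auto simp: min_dense_def is_dense_def)
  obtain h where netflow: "\<And>v. netflow h v = 0" and h0: "\<And>e. e \<notin> F \<Longrightarrow> h e = 0"
    and hF: "\<And>e. e \<in> F \<Longrightarrow> h e = x \<or> h e = - x" using min_dense_circulation[OF F, of x] by blast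
  \<comment> \<open>The restriction makes \<open>g\<close> extensional, as flows must be.\<close>
  define g where "g = restrict (\<lambda>e. f e + h e) (arcs G)"
  have "netflow g v = netflow f v + netflow h v" for v
    unfolding netflow_add[symmetric] by (auto simp: netflow_def g_def intro!: arg_cong2[where f = minus] sum.cong)
  then have "netflow g v = 0" if "v \<in> verts G" for v
    using that netflow nowhere_zero_flow_netflow[OF f] by simp
  then have "flow G g" by (simp add: flow_def netflow_def g_def)
  moreover have "g e \<noteq> 0" if "e \<in> arcs G" for e
  proof (cases "e \<in> F")
    case True
    then show ?thesis using hF[OF True] avoid[OF True] that
      by (auto simp: g_def add_eq_0_iff2)
  next
    case False
    then show ?thesis using f h0 that by (simp add: g_def nowhere_zero_flow_def)
  qed
  ultimately have "nowhere_zero_flow G g" by (simp add: nowhere_zero_flow_def)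
  moreover have "flow_support G (\<lambda>e. f e - g e) = F"
    using FG h0 hF x by (fastforce simp: flow_support_def g_def)
  ultimately have "(f, g) \<in> parcs (reconf_graph G)"
    using f min_dense_cycle_of[OF F] by (force simp: reconf_graph_def)
  then show thesis by (rule that)
qed

end

section \<open>Using the hypotheses on the graph and the group\<close>

text \<open>The definition provides two distinct vertices, and deleting the empty edge set shows
  them to be joined by a path.\<close>

lemma edge_connected_arcs_nonempty:
  assumes "edge_connected 2 G"
  shows "arcs G \<noteq> {}"
proof
  assume empty: "arcs G = {}"
  obtain u v where uv: "u \<in> verts G" "v \<in> verts G" "u \<noteq> v"
    using assms by (auto simp: edge_connected_def)
  have "Digraph_Component.connected (G\<lparr>arcs := arcs G - {}\<rparr>)"
    using assms unfolding edge_connected_def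
    by (metis card.empty empty_subsetI finite.emptyI zero_less_numeral)
  then have "Digraph_Component.connected G" by simp
  then have "(u, v) \<in> rtrancl_on (verts G) ((arcs_ends G)\<^sup>s)" using uv by (simp add: connected_conv)
  then show False using uv(3)
    by (cases rule: rtrancl_on.cases) (auto simp: empty arcs_ends_def symcl_def)
qed

text \<open>Greedy choice: the last element avoids 0, \<plusminus>a and \<plusminus>b, at most five
  values, whence the bound 6. In the Klein four-group each element is its own negative, so the three
  non-zero elements form three classes.\<close>

lemma ex_three_sign_classes:
  assumes "ecard (UNIV :: 'a::ab_group_add set) \<ge> 6 \<or> (\<exists>h :: bit \<times> bit \<Rightarrow> 'a. additive_iso h)"
  obtains a b c :: "'a::ab_group_add" where "0 \<notin> {a, b, c}" "b \<notin> {a, - a}" "c \<notin> {a, - a, b, - b}"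
  using assms
proof
  assume large: "ecard (UNIV :: 'a set) \<ge> 6"
  have avoid: "\<exists>y. y \<notin> A" if "finite A" "card A < 6" for A :: "'a set"
  proof (rule ccontr)
    assume "\<nexists>y. y \<notin> A"
    then have "A = UNIV" by auto
    then show False using large that by (simp add: ecard_def numeral_eq_enat)
  qed
  \<comment> \<open>The length of a list bounds the number of values whether or not coincidences
    such as \<open>a = - a\<close> occur.\<close>
  have len: "\<exists>y. y \<notin> set xs" if "length xs < 6" for xs :: "'a list"
    using avoid[of "set xs"] card_length[of xs] that by simp
  obtain a :: 'a where "a \<notin> {0}" using len[of "[0]"] by auto
  moreover obtain b :: 'a where "b \<notin> {0, a, - a}" using len[of "[0, a, - a]"] by auto
  moreover obtain c :: 'a where "c \<notin> {0, a, - a, b, - b}" using len[of "[0, a, - a, b, - b]"] by auto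
  ultimately show thesis using that by auto
next
  assume "\<exists>h :: bit \<times> bit \<Rightarrow> 'a. additive_iso h"
  then obtain h :: "bit \<times> bit \<Rightarrow> 'a" where h: "additive_iso h" ..
  have inj: "h x = h y \<longleftrightarrow> x = y" for x y
    using h by (auto simp only: additive_iso_def bij_def inj_eq)
  have add: "h (x + y) = h x + h y" for x y
    using h unfolding additive_iso_def by blast
  have h0: "h 0 = 0" using add[of 0 0] by simp
  have "x + x = 0" for x :: "bit \<times> bit" by (cases x) (simp add: zero_prod_def)
  then have "h x + h x = 0" for x using add[of x x] h0 by simp
  then have neg: "- h x = h x" for x by (simp add: add_eq_0_iff2)
  have nz: "h x \<noteq> 0" if "x \<noteq> 0" for x using that inj[of x 0] h0 by simp
  show thesis
    by (rule that[of "h (0, 1)" "h (1, 0)" "h (1, 1)"])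
      (use nz[of "(0, 1)"] nz[of "(1, 0)"] nz[of "(1, 1)"] in \<open>auto simp: neg inj zero_prod_def\<close>)
qed

theorem theorem3p2:
  fixes G :: "('v, 'e) pre_digraph"
  assumes "fin_digraph G" and "loopfree_digraph G"
    and "edge_connected 2 G"
    and "ecard (UNIV :: 'a::ab_group_add set) \<ge> 6 \<or> (\<exists>h :: bit \<times> bit \<Rightarrow> 'a. additive_iso h)"
    and "pverts (reconf_graph G :: ('e \<Rightarrow> 'a) pair_pre_digraph) \<noteq> {}"
  shows "\<forall>f \<in> pverts (reconf_graph G :: ('e \<Rightarrow> 'a) pair_pre_digraph).
           vertex_degree (reconf_graph G) f \<ge> 1"
proof
  interpret fin_digraph G by fact
  interpret loopfree_digraph G by fact
  interpret loopfree_fin_digraph G by unfold_locales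
  fix f :: "'e \<Rightarrow> 'a" assume "f \<in> pverts (reconf_graph G)"
  then have f: "nowhere_zero_flow G f" by (simp add: reconf_graph_def)
  have ne: "arcs G \<noteq> {}" using assms(3) by (rule edge_connected_arcs_nonempty)
  obtain a b c :: 'a where nz: "0 \<notin> {a, b, c}" and abc: "b \<notin> {a, - a}" "c \<notin> {a, - a, b, - b}"
    using ex_three_sign_classes[OF assms(4)] .
  obtain x F where x: "x \<in> {a, b, c}" and F: "min_dense F" "\<And>e. e \<in> F \<Longrightarrow> f e \<notin> {x, - x}"
    using nowhere_zero_flow_min_dense_avoiding[OF f ne abc] by blast
  have "x \<noteq> 0" using x nz by auto
  then obtain g where "(f, g) \<in> parcs (reconf_graph G)"
    using nowhere_zero_flow_add_circulation[OF f F(1) _ F(2)] by blast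
  \<comment> \<open>One neighbour suffices also when there are infinitely many, since the degree is
    then \<infinity>.\<close>
  then have "{g. (f, g) \<in> parcs (reconf_graph G)} \<noteq> {}" by blast
  then show "vertex_degree (reconf_graph G) f \<ge> 1"
    by (auto simp: vertex_degree_def ecard_def one_enat_def Suc_le_eq card_gt_0_iff)
qed

end
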